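(* Let $(X,\mathcal{F})$ be a measurable space with $\mathcal{F}$ countably generated, let $\mathcal{E}$ be a sub-$\sigma$-algebra of $\mathcal{F}$, and let $\pi$ be an $\mathcal{E}$-measurable quasi-probability kernel. If $\mathcal{E}$ is countably generated, then there exists a proper $\mathcal{E}$-measurable refinement $\varrho$ of $\pi$.
   Context: $\mathrm{P}(\mathcal{F})$ denotes the set of probability measures on $(X,\mathcal{F})$ and $\mathbb{R}^+=[0,\infty)$. A quasi-probability kernel is a mapping $\pi : X\times\mathcal{F}\to\mathbb{R}^+$ such that $\pi(\cdot,F)$ is $\mathcal{F}$-measurable for each $F\in\mathcal{F}$ and $\pi(x,\cdot)$ is a measure on $(X,\mathcal{F})$ with $\pi(x,X)\in\{0,1\}$ for each $x\in X$. It is $\mathcal{E}$-measurable if $\pi(\cdot,F)$ is $\mathcal{E}$-measurable for each $F\in\mathcal{F}$. For an $\mathcal{E}$-measurable quasi-probability kernel $\pi$ put $\mathcal{J}_{\mathcal{E}}(\pi)=\{\mu\in\mathrm{P}(\mathcal{F}) : \mu(E\cap F)=\int I_E\,\pi(\cdot,F)\,d\mu \text{ for all } E\in\mathcal{E},\ F\in\mathcal{F}\}$, where $I_E$ is the indicator function of $E$. The kernel $\pi$ is proper if $\pi(\cdot,E\cap F)=I_E\,\pi(\cdot,F)$ for all $E\in\mathcal{E}$, $F\in\mathcal{F}$. For $D\in\mathcal{E}$ the restriction of $\pi$ to $D$ is the $\mathcal{E}$-measurable quasi-probability kernel $(x,F)\mapsto I_D(x)\pi(x,F)$. An $\mathcal{E}$-measurable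 quasi-probability kernel $\varrho$ is a refinement of $\pi$ if $\varrho$ is the restriction of $\pi$ to $D$ for some $D\in\mathcal{E}$ and $\mathcal{J}_{\mathcal{E}}(\varrho)=\mathcal{J}_{\mathcal{E}}(\pi)$. *)

theory Defs
  imports "HOL-Probability.Probability"
begin

text \<open>A measurable space \<open>(X, F)\<close> is given by a measure \<open>M\<close> through \<open>space M\<close> and \<open>sets M\<close>, and
  a sub-\<open>\<sigma>\<close>-algebra by a measure \<open>N\<close> with \<^term>\<open>subalgebra M N\<close>; the values of these two measures
  play no role. A kernel \<open>\<pi>\<close> is a measure-valued map, \<open>\<pi>(x, A)\<close> being \<^term>\<open>emeasure (\<pi> x) A\<close>. Only
  its values at points of \<^term>\<open>space M\<close> matter.\<close>

definition countably_generated :: "'a measure \<Rightarrow> bool" where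
  "countably_generated M \<longleftrightarrow>
     (\<exists>G. countable G \<and> G \<subseteq> Pow (space M) \<and> sets M = sigma_sets (space M) G)"

definition quasi_prob_kernel :: "'a measure \<Rightarrow> ('a \<Rightarrow> 'a measure) \<Rightarrow> bool" where
  "quasi_prob_kernel M \<pi> \<longleftrightarrow>
     (\<forall>A\<in>sets M. (\<lambda>x. emeasure (\<pi> x) A) \<in> borel_measurable M) \<and>
     (\<forall>x\<in>space M. sets (\<pi> x) = sets M \<and> emeasure (\<pi> x) (space M) \<in> {0, 1})"

definition measurable_quasi_prob_kernel ::
    "'a measure \<Rightarrow> 'a measure \<Rightarrow> ('a \<Rightarrow> 'a measure) \<Rightarrow> bool" where
  "measurable_quasi_prob_kernel M N \<pi> \<longleftrightarrow>
     quasi_prob_kernel M \<pi> \<and> (\<forall>A\<in>sets M. (\<lambda>x. emeasure (\<pi> x) A) \<in> borel_measurable N)"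

text \<open>The set \<open>J\<close> of probability measures for which \<open>\<pi>\<close> is a conditional probability given \<open>N\<close>.
  \<^term>\<open>space (prob_algebra M)\<close> is the set of all probability measures on the measurable space of
  \<open>M\<close>.\<close>

definition kernel_measures ::
    "'a measure \<Rightarrow> 'a measure \<Rightarrow> ('a \<Rightarrow> 'a measure) \<Rightarrow> 'a measure set" where
  "kernel_measures M N \<pi> =
     {\<mu> \<in> space (prob_algebra M). \<forall>E\<in>sets N. \<forall>A\<in>sets M.
        emeasure \<mu> (E \<inter> A) = (\<integral>\<^sup>+x. indicator E x * emeasure (\<pi> x) A \<partial>\<mu>)}"

definition proper_kernel :: "'a measure \<Rightarrow> 'a measure \<Rightarrow> ('a \<Rightarrow> 'a measure) \<Rightarrow> bool" where
  "proper_kernel M N \<pi> \<longleftrightarrow>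
     (\<forall>E\<in>sets N. \<forall>A\<in>sets M. \<forall>x\<in>space M.
        emeasure (\<pi> x) (E \<inter> A) = indicator E x * emeasure (\<pi> x) A)"

definition is_kernel_restriction ::
    "'a measure \<Rightarrow> ('a \<Rightarrow> 'a measure) \<Rightarrow> 'a set \<Rightarrow> ('a \<Rightarrow> 'a measure) \<Rightarrow> bool" where
  "is_kernel_restriction M \<pi> D \<rho> \<longleftrightarrow>
     (\<forall>x\<in>space M. \<forall>A\<in>sets M. emeasure (\<rho> x) A = indicator D x * emeasure (\<pi> x) A)"

definition kernel_refinement ::
    "'a measure \<Rightarrow> 'a measure \<Rightarrow> ('a \<Rightarrow> 'a measure) \<Rightarrow> ('a \<Rightarrow> 'a measure) \<Rightarrow> bool" where
  "kernel_refinement M N \<pi> \<rho> \<longleftrightarrow>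
     measurable_quasi_prob_kernel M N \<rho> \<and>
     (\<exists>D\<in>sets N. is_kernel_restriction M \<pi> D \<rho>) \<and>
     kernel_measures M N \<rho> = kernel_measures M N \<pi>"

end

theory Submission
  imports Defs
begin

text \<open>Let \<open>G\<close> be a countable generator of the small \<open>\<sigma>\<close>-algebra \<open>N\<close>. Properness at a point \<open>x\<close>
  says that \<open>\<pi> x\<close> lives on the set of points that no element of \<open>N\<close> separates from \<open>x\<close>. Points
  that \<open>G\<close> does not separate are not separated by any element of \<open>N\<close>, so properness at \<open>x\<close> is
  the conjunction of the countably many conditions ``\<open>\<pi> x\<close>-almost every \<open>y\<close> lies on the same side
  of \<open>C\<close> as \<open>x\<close>'', where \<open>C \<in> G\<close>. The set \<open>D\<close> of all \<open>x\<close> with this property is therefore in \<open>N\<close>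
  (lemma \<open>proper_points_measurable\<close>), and cutting \<open>\<pi>\<close> off outside \<open>D\<close> gives a proper kernel
  (lemma \<open>emeasure_Int_proper_point\<close>).

  It remains to see that the cut-off does not change the measures \<open>\<mu>\<close> for which the kernel is a
  conditional probability. It cannot do so if \<open>D\<close> has full \<open>\<mu>\<close>-measure, and \<open>D\<close> has full measure
  for both kernels. If \<open>\<mu>\<close> belongs to \<open>\<pi>\<close>, then the mass that \<open>\<pi> x\<close> puts across the border
  of \<open>C\<close> integrates to \<open>\<mu> ((X - C) \<inter> C) + \<mu> (C \<inter> (X - C)) = 0\<close>
  (lemma \<open>AE_proper_point\<close>). If \<open>\<mu>\<close> belongs to the cut-off kernel, the total mass \<open>1\<close> of \<open>\<mu>\<close> is
  the integral of a function that vanishes off \<open>D\<close> and is at most \<open>1\<close>.\<close>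

definition proper_points :: "'a measure \<Rightarrow> 'a set set \<Rightarrow> ('a \<Rightarrow> 'a measure) \<Rightarrow> 'a set" where
  "proper_points M G \<pi> = {x \<in> space M. \<forall>C\<in>G. AE y in \<pi> x. y \<in> C \<longleftrightarrow> x \<in> C}"

definition kernel_cutoff ::
    "'a measure \<Rightarrow> ('a \<Rightarrow> 'a measure) \<Rightarrow> 'a set \<Rightarrow> 'a \<Rightarrow> 'a measure" where
  "kernel_cutoff M \<pi> D x = (if x \<in> D then \<pi> x else null_measure M)"

lemma sets_kernel:
  assumes "measurable_quasi_prob_kernel M N \<pi>" "x \<in> space M"
  shows "sets (\<pi> x) = sets M"
  using assms by (simp add: measurable_quasi_prob_kernel_def quasi_prob_kernel_def)

lemma emeasure_kernel_cutoff:
  "emeasure (kernel_cutoff M \<pi> D x) A = indicator D x * emeasure (\<pi> x) A"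
  by (simp add: kernel_cutoff_def)

lemma sigma_sets_not_separated:
  assumes "E \<in> sigma_sets X G" and "x \<in> X" "y \<in> X"
    and "\<And>C. C \<in> G \<Longrightarrow> y \<in> C \<longleftrightarrow> x \<in> C"
  shows "y \<in> E \<longleftrightarrow> x \<in> E"
  using assms(1) by induction (use assms in auto)

lemma AE_same_side_iff:
  assumes "sets K = sets M" "C \<in> sets M"
  shows "(AE y in K. y \<in> C \<longleftrightarrow> x \<in> C) \<longleftrightarrow>
    (if x \<in> C then emeasure K (space M - C) = 0 else emeasure K C = 0)"
proof -
  have "space K = space M"
    using assms(1) by (rule sets_eq_imp_space_eq)
  then have "{y \<in> space K. \<not> (y \<in> C \<longleftrightarrow> x \<in> C)} = (if x \<in> C then space M - C else C)"
    using sets.sets_into_space[OF assms(2)] by auto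
  moreover have "(if x \<in> C then space M - C else C) \<in> sets K"
    unfolding assms(1) using assms(2) by simp
  ultimately have "(AE y in K. y \<in> C \<longleftrightarrow> x \<in> C) \<longleftrightarrow>
      emeasure K (if x \<in> C then space M - C else C) = 0"
    by (rule AE_iff_measurable[rotated])
  then show ?thesis
    by (simp only: if_distrib[of "\<lambda>A. emeasure K A = 0"])
qed

lemma proper_points_measurable:
  assumes "subalgebra M N" "measurable_quasi_prob_kernel M N \<pi>"
    and "countable G" "G \<subseteq> sets N"
  shows "proper_points M G \<pi> \<in> sets N"
proof -
  have sp: "space N = space M" and sub: "sets N \<subseteq> sets M"
    using assms(1) by (auto simp: subalgebra_def)
  have "(AE y in \<pi> x. y \<in> C \<longleftrightarrow> x \<in> C) \<longleftrightarrow>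
      (if x \<in> C then emeasure (\<pi> x) (space M - C) = 0 else emeasure (\<pi> x) C = 0)"
    if "x \<in> space M" "C \<in> G" for x C
    by (rule AE_same_side_iff[OF sets_kernel[OF assms(2) that(1)]]) (use that assms(4) sub in blast)
  then have "proper_points M G \<pi> = {x \<in> space N. \<forall>C\<in>G.
      if x \<in> C then emeasure (\<pi> x) (space M - C) = 0 else emeasure (\<pi> x) C = 0}"
    unfolding proper_points_def sp by (intro Collect_cong conj_cong refl ball_cong)
  also have "\<dots> \<in> sets N"
  proof (rule sets.sets_Collect_countable_All'[OF _ assms(3)])
    fix C assume "C \<in> G"
    then have C [measurable]: "C \<in> sets N" and "C \<in> sets M"
      using assms(4) sub by auto
    then have [measurable]: "(\<lambda>x. emeasure (\<pi> x) C) \<in> borel_measurable N"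
        "(\<lambda>x. emeasure (\<pi> x) (space M - C)) \<in> borel_measurable N"
      using assms(2) by (auto simp: measurable_quasi_prob_kernel_def)
    show "{x \<in> space N. if x \<in> C then emeasure (\<pi> x) (space M - C) = 0
        else emeasure (\<pi> x) C = 0} \<in> sets N"
      by measurable
  qed
  finally show ?thesis .
qed

text \<open>Countability of \<open>G\<close> lets the exceptional null sets be merged; off their union, \<open>y\<close> is not
  separated from \<open>x\<close> by any set of \<open>N\<close>. So \<open>E\<close> is, up to a null set, everything or nothing.\<close>

lemma emeasure_Int_proper_point:
  assumes "subalgebra M N" "countable G" "sets N = sigma_sets (space N) G"
    and "x \<in> proper_points M G \<pi>" "sets (\<pi> x) = sets M"
    and "E \<in> sets N" "A \<in> sets M"
  shows "emeasure (\<pi> x) (E \<inter> A) = indicator E x * emeasure (\<pi> x) A"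
proof -
  have sp: "space N = space M" and [measurable]: "E \<in> sets (\<pi> x)" "A \<in> sets (\<pi> x)"
    using assms by (auto simp: subalgebra_def)
  have x: "x \<in> space M" "\<And>C. C \<in> G \<Longrightarrow> AE y in \<pi> x. y \<in> C \<longleftrightarrow> x \<in> C"
    using assms(4) by (auto simp: proper_points_def)
  have sp\<pi>: "space (\<pi> x) = space M"
    using assms(5) by (rule sets_eq_imp_space_eq)
  have "AE y in \<pi> x. \<forall>C\<in>G. y \<in> C \<longleftrightarrow> x \<in> C"
    using x(2) by (simp add: AE_ball_countable[OF assms(2)])
  with AE_space have "AE y in \<pi> x. y \<in> E \<longleftrightarrow> x \<in> E"
  proof eventually_elim
    case (elim y)
    have "E \<in> sigma_sets (space M) G"
      using assms(3,6) by (simp add: sp)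
    then show ?case
      by (rule sigma_sets_not_separated) (use elim x(1) sp\<pi> in auto)
  qed
  then have "AE y in \<pi> x. y \<in> E \<inter> A \<longleftrightarrow> y \<in> (if x \<in> E then A else {})"
    by eventually_elim auto
  then have "emeasure (\<pi> x) (E \<inter> A) = emeasure (\<pi> x) (if x \<in> E then A else {})"
    by (rule emeasure_eq_AE) auto
  then show ?thesis by simp
qed

text \<open>Testing the conditional probability on disjoint \<open>E\<close> and \<open>A\<close> shows that \<open>\<pi> x\<close> almost surely
  does not charge \<open>A\<close> for \<open>x \<in> E\<close>. With \<open>C\<close> and its complement in the roles of \<open>E\<close> and \<open>A\<close>, in
  both orders, this says that no mass crosses the border of \<open>C\<close>.\<close>

lemma AE_proper_point:
  assumes "subalgebra M N" "measurable_quasi_prob_kernel M N \<pi>"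
    and "countable G" "G \<subseteq> sets N"
    and "\<mu> \<in> kernel_measures M N \<pi>"
  shows "AE x in \<mu>. x \<in> proper_points M G \<pi>"
proof -
  have sp: "space N = space M" and sub: "sets N \<subseteq> sets M"
    using assms(1) by (auto simp: subalgebra_def)
  have sets_\<mu> [measurable_cong]: "sets \<mu> = sets M"
    using assms(5) by (simp add: kernel_measures_def space_prob_algebra)
  then have sp\<mu>: "space \<mu> = space M"
    by (rule sets_eq_imp_space_eq)
  have null: "AE x in \<mu>. x \<in> E \<longrightarrow> emeasure (\<pi> x) A = 0"
    if E: "E \<in> sets N" and A: "A \<in> sets M" and disj: "E \<inter> A = {}" for E A
  proof -
    have [measurable]: "(\<lambda>x. emeasure (\<pi> x) A) \<in> borel_measurable M" "E \<in> sets M"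
      using assms(2) A E sub
      by (auto simp: measurable_quasi_prob_kernel_def quasi_prob_kernel_def)
    have "(\<integral>\<^sup>+x. indicator E x * emeasure (\<pi> x) A \<partial>\<mu>) = emeasure \<mu> (E \<inter> A)"
      using assms(5) E A by (simp add: kernel_measures_def)
    then have "AE x in \<mu>. indicator E x * emeasure (\<pi> x) A = 0"
      by (subst (asm) disj, subst (asm) emeasure_empty, subst (asm) nn_integral_0_iff_AE) auto
    then show ?thesis
      by eventually_elim (auto simp: indicator_def split: if_splits)
  qed
  have "AE x in \<mu>. AE y in \<pi> x. y \<in> C \<longleftrightarrow> x \<in> C" if "C \<in> G" for C
  proof -
    have C: "C \<in> sets N" "space M - C \<in> sets N" "C \<in> sets M"
      using that assms(4) sub sp sets.compl_sets[of C N] by auto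
    have "AE x in \<mu>. x \<in> C \<longrightarrow> emeasure (\<pi> x) (space M - C) = 0"
        "AE x in \<mu>. x \<in> space M - C \<longrightarrow> emeasure (\<pi> x) C = 0"
      using C sub by (blast intro: null)+
    then show ?thesis
      using AE_space
    proof eventually_elim
      case (elim x)
      then have "sets (\<pi> x) = sets M"
        using sets_kernel[OF assms(2)] sp\<mu> by simp
      from AE_same_side_iff[OF this C(3), of x] elim show ?case
        by (simp add: sp\<mu>)
    qed
  qed
  then have "AE x in \<mu>. \<forall>C\<in>G. AE y in \<pi> x. y \<in> C \<longleftrightarrow> x \<in> C"
    by (simp add: AE_ball_countable[OF assms(3)])
  with AE_space show ?thesis
    by eventually_elim (simp add: proper_points_def sp\<mu>)
qed

lemma measurable_quasi_prob_kernel_cutoff: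
  assumes "subalgebra M N" "measurable_quasi_prob_kernel M N \<pi>" "D \<in> sets N"
  shows "measurable_quasi_prob_kernel M N (kernel_cutoff M \<pi> D)"
proof -
  have "D \<in> sets M"
    using assms(1,3) by (auto simp: subalgebra_def)
  then show ?thesis
    using assms(2,3)
    unfolding measurable_quasi_prob_kernel_def quasi_prob_kernel_def emeasure_kernel_cutoff
    by (auto simp: kernel_cutoff_def intro!: borel_measurable_times)
qed

lemma kernel_measures_cutoff_iff:
  assumes "AE x in \<mu>. x \<in> D"
  shows "\<mu> \<in> kernel_measures M N (kernel_cutoff M \<pi> D) \<longleftrightarrow> \<mu> \<in> kernel_measures M N \<pi>"
proof -
  have "(\<integral>\<^sup>+x. indicator E x * emeasure (kernel_cutoff M \<pi> D x) A \<partial>\<mu>) =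
      (\<integral>\<^sup>+x. indicator E x * emeasure (\<pi> x) A \<partial>\<mu>)" for E A
    using assms by (intro nn_integral_cong_AE) (auto simp: kernel_cutoff_def)
  then show ?thesis
    by (simp add: kernel_measures_def)
qed

lemma AE_cutoff_set:
  assumes "subalgebra M N" "measurable_quasi_prob_kernel M N \<pi>" "D \<in> sets N"
    and "\<mu> \<in> kernel_measures M N (kernel_cutoff M \<pi> D)"
  shows "AE x in \<mu>. x \<in> D"
proof -
  have sp: "space N = space M" and D: "D \<in> sets M"
    using assms(1,3) by (auto simp: subalgebra_def)
  have sets_\<mu>: "sets \<mu> = sets M" and "prob_space \<mu>"
    using assms(4) by (auto simp: kernel_measures_def space_prob_algebra)
  then interpret prob_space \<mu> by simp
  have sp\<mu>: "space \<mu> = space M"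
    using sets_\<mu> by (rule sets_eq_imp_space_eq)
  have "emeasure \<mu> (space M \<inter> space M) =
      (\<integral>\<^sup>+x. indicator (space M) x * emeasure (kernel_cutoff M \<pi> D x) (space M) \<partial>\<mu>)"
    using assms(4) sets.top[of N] unfolding kernel_measures_def sp by blast
  also have "\<dots> \<le> (\<integral>\<^sup>+x. indicator D x \<partial>\<mu>)"
    using assms(2) sp\<mu>
    by (intro nn_integral_mono)
      (force simp: kernel_cutoff_def measurable_quasi_prob_kernel_def quasi_prob_kernel_def)
  also have "\<dots> = emeasure \<mu> D"
    using D sets_\<mu> by simp
  finally have "1 \<le> emeasure \<mu> D"
    using emeasure_space_1 by (simp add: sp\<mu>)
  then have "emeasure \<mu> D = 1"
    by (intro antisym emeasure_le_1)
  then show ?thesis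
    using D sets_\<mu> by (subst AE_in_set_eq_1) (auto simp: measure_def)
qed

theorem theorem1:
  fixes M N :: "'a measure" and \<pi> :: "'a \<Rightarrow> 'a measure"
  assumes "countably_generated M"
    and "subalgebra M N"
    and "measurable_quasi_prob_kernel M N \<pi>"
    and "countably_generated N"
  shows "\<exists>\<rho>. kernel_refinement M N \<pi> \<rho> \<and> proper_kernel M N \<rho>"
proof -
  obtain G where G: "countable G" "sets N = sigma_sets (space N) G"
    using assms(4) by (auto simp: countably_generated_def)
  then have GN: "G \<subseteq> sets N"
    by (auto intro: sigma_sets.Basic)
  define D where "D = proper_points M G \<pi>"
  have D: "D \<in> sets N"
    unfolding D_def using assms(2,3) G(1) GN by (rule proper_points_measurable)
  have "kernel_measures M N (kernel_cutoff M \<pi> D) = kernel_measures M N \<pi>"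
    using AE_cutoff_set[OF assms(2,3) D] AE_proper_point[OF assms(2,3) G(1) GN]
      kernel_measures_cutoff_iff
    unfolding D_def by blast
  then have "kernel_refinement M N \<pi> (kernel_cutoff M \<pi> D)"
    using measurable_quasi_prob_kernel_cutoff[OF assms(2,3) D] D
    by (auto simp: kernel_refinement_def is_kernel_restriction_def emeasure_kernel_cutoff)
  moreover have "proper_kernel M N (kernel_cutoff M \<pi> D)"
    unfolding proper_kernel_def
  proof (intro ballI)
    fix E A x assume E: "E \<in> sets N" and A: "A \<in> sets M" and x: "x \<in> space M"
    have "sets (\<pi> x) = sets M"
      using assms(3) x by (rule sets_kernel)
    then show "emeasure (kernel_cutoff M \<pi> D x) (E \<inter> A) =
        indicator E x * emeasure (kernel_cutoff M \<pi> D x) A"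
      using emeasure_Int_proper_point[OF assms(2) G _ _ E A]
      by (simp add: kernel_cutoff_def D_def)
  qed
  ultimately show ?thesis by blast
qed

end
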